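(* Let $G_0$ be a finite simple undirected graph and let $w_1,w_2,\ldots$ be distinct new vertices not in $V(G_0)$. Define graphs $G_1,G_2,\ldots$ recursively by $G_i=G_{i-1}\cup w_i$ if $i\ge 1$ is odd and $G_i=G_{i-1}\vee w_i$ if $i\ge1$ is even. Let $a:=|\det(A(G_0))|$, $b:=|\det(W(G_0))|$ and $p:=|\det(A(\overline{G}_1))|$, where $\overline{G}_1$ is the complement of $G_1$. Then for all $i\ge 1$, $$|\det(W(G_i))|=a^{\lceil i/2\rceil}\, b\, p^{\lfloor i/2\rfloor}.$$
   Context: For a graph $H$, $A(H)$ denotes its adjacency matrix and $W(H)=[e,A(H)e,\ldots,A(H)^{m-1}e]$ its walk matrix, where $m=|V(H)|$ and $e$ is the all-ones vector of length $m$. For a graph $H$ and a new vertex $w\notin V(H)$, $H\cup w$ is obtained from $H$ by adding $w$ as an isolated vertex, and $H\vee w$ is obtained from $H$ by adding $w$ and joining it to every vertex of $H$. *)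

theory Defs
  imports "Jordan_Normal_Form.Determinant" "Graph_Theory.Pair_Digraph"
begin

text \<open>
  Finite simple undirected graphs are the instances of the locale \<^locale>\<open>pair_graph\<close>:
  finite, loop-free, and with a symmetric arc set, each edge being present as two arcs.
\<close>

definition graph_complement :: "'a pair_pre_digraph \<Rightarrow> 'a pair_pre_digraph" where
  "graph_complement H =
     \<lparr> pverts = pverts H,
       parcs = {(u, v). u \<in> pverts H \<and> v \<in> pverts H \<and> u \<noteq> v \<and> (u, v) \<notin> parcs H} \<rparr>"

text \<open>The graphs $H \cup w$ and $H \vee w$; both are meant for $w \notin V(H)$.\<close>

definition add_isolated_vertex :: "'a pair_pre_digraph \<Rightarrow> 'a \<Rightarrow> 'a pair_pre_digraph" where
  "add_isolated_vertex H w = \<lparr> pverts = insert w (pverts H), parcs = parcs H \<rparr>"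

definition join_vertex :: "'a pair_pre_digraph \<Rightarrow> 'a \<Rightarrow> 'a pair_pre_digraph" where
  "join_vertex H w =
     \<lparr> pverts = insert w (pverts H),
       parcs = parcs H \<union> {w} \<times> pverts H \<union> pverts H \<times> {w} \<rparr>"

text \<open>
  Matrices of a graph are taken with respect to an enumeration of its vertices, given as a
  list. Changing the enumeration conjugates the adjacency matrix by a permutation matrix and
  permutes the rows of the walk matrix, so the absolute values of the determinants do not
  depend on it.
\<close>

definition enumerates :: "'a list \<Rightarrow> 'a pair_pre_digraph \<Rightarrow> bool" where
  "enumerates xs H \<longleftrightarrow> distinct xs \<and> set xs = pverts H"

definition adjacency_matrix :: "'a pair_pre_digraph \<Rightarrow> 'a list \<Rightarrow> int mat" where
  "adjacency_matrix H xs =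
     mat (length xs) (length xs) (\<lambda>(i, j). if (xs ! i, xs ! j) \<in> parcs H then 1 else 0)"

definition walk_matrix :: "'a pair_pre_digraph \<Rightarrow> 'a list \<Rightarrow> int mat" where
  "walk_matrix H xs =
     (let m = length xs; e = vec m (\<lambda>_. 1)
      in mat_of_cols m (map (\<lambda>k. (adjacency_matrix H xs ^\<^sub>m k) *\<^sub>v e) [0..<m]))"

end

theory Submission
  imports Defs
begin

text \<open>
  Adding an isolated vertex $w$ to $H$ turns every walk vector except $e$ into $(A^k e, 0)$, so
  $|\det W(H \cup w)| = |\det A(H)| |\det W(H)|$. The complement has adjacency matrix
  $J - I - A$, hence the walk matrices of $H$ and of its complement differ by a unitriangular
  factor up to signs; since $H \vee w$ is the complement of $\overline{H} \cup w$, this gives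
  $|\det W(H \vee w)| = |\det A(\overline{H})| |\det W(H)|$. Finally, passing from $H$ to
  $(H \cup u) \vee v$ adds a pendant vertex $u$ whose only neighbour is $v$, so expanding along its
  row and column shows that $|\det A|$ is unchanged. This applies to $G_i$ for even $i$ and, by
  complementation, to $\overline{G}_i$ for odd $i$.
\<close>

section \<open>Walk counts as entries of the walk matrix\<close>

text \<open>The number of walks with \<open>k\<close> arcs starting at \<open>v\<close>, that is,
  the entry of \<open>A^k e\<close> at \<open>v\<close>. Indexing by vertices instead of list
  positions lets graphs be compared without fixing an enumeration.\<close>

primrec num_walks :: "'a pair_pre_digraph \<Rightarrow> nat \<Rightarrow> 'a \<Rightarrow> int" where
  "num_walks H 0 v = 1"
| "num_walks H (Suc k) v = (\<Sum>u\<in>pverts H. of_bool ((v, u) \<in> parcs H) * num_walks H k u)"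

lemma enumerates_finite: "enumerates xs H \<Longrightarrow> finite (pverts H)"
  unfolding enumerates_def by (metis List.finite_set)

lemma enumerates_sum:
  assumes "enumerates xs H"
  shows "(\<Sum>i<length xs. f (xs ! i)) = (\<Sum>u\<in>pverts H. f u)"
proof -
  have "(\<Sum>i<length xs. f (xs ! i)) = sum f ((!) xs ` {..<length xs})"
    using assms by (subst sum.reindex) (auto simp: enumerates_def inj_on_nth)
  also have "(!) xs ` {..<length xs} = pverts H"
    using assms by (auto simp: enumerates_def set_conv_nth)
  finally show ?thesis .
qed

lemma adjacency_matrix_index [simp]:
  "i < length xs \<Longrightarrow> j < length xs \<Longrightarrow>
    adjacency_matrix H xs $$ (i, j) = of_bool ((xs ! i, xs ! j) \<in> parcs H)"
  by (simp add: adjacency_matrix_def)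

lemma adjacency_matrix_carrier [simp]:
  "adjacency_matrix H xs \<in> carrier_mat (length xs) (length xs)"
  by (simp add: adjacency_matrix_def)

text \<open>Matrix powers unfold with the extra factor on the right, whereas the recursion of
  \<open>num_walks\<close> splits off the first arc of a walk and so needs it on the left.\<close>

lemma pow_mat_Suc_left:
  assumes A: "A \<in> carrier_mat n n"
  shows "A ^\<^sub>m Suc k = A * A ^\<^sub>m k"
proof (induction k)
  case (Suc k)
  have "A ^\<^sub>m Suc (Suc k) = (A * A ^\<^sub>m k) * A" using Suc.IH by simp
  also have "\<dots> = A * (A ^\<^sub>m k * A)"
    by (rule assoc_mult_mat[OF A pow_carrier_mat[OF A] A])
  finally show ?case by simp
qed (use A in simp)

lemma adjacency_matrix_power_vec:
  assumes xs: "enumerates xs H"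
  shows "(adjacency_matrix H xs ^\<^sub>m k) *\<^sub>v vec (length xs) (\<lambda>_. 1) =
    vec (length xs) (\<lambda>i. num_walks H k (xs ! i))"
proof (induction k)
  case 0
  then show ?case by (auto simp: adjacency_matrix_def)
next
  case (Suc k)
  let ?A = "adjacency_matrix H xs" and ?n = "length xs"
  have "?A ^\<^sub>m Suc k = ?A * ?A ^\<^sub>m k"
    by (rule pow_mat_Suc_left[OF adjacency_matrix_carrier])
  then have "(?A ^\<^sub>m Suc k) *\<^sub>v vec ?n (\<lambda>_. 1) = ?A *\<^sub>v vec ?n (\<lambda>i. num_walks H k (xs ! i))"
    using Suc.IH by (simp add: assoc_mult_mat_vec[of _ ?n ?n _ ?n])
  also have "\<dots> = vec ?n (\<lambda>i. num_walks H (Suc k) (xs ! i))"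
  proof (rule eq_vecI)
    fix i assume "i < dim_vec (vec ?n (\<lambda>i. num_walks H (Suc k) (xs ! i)))"
    then have i: "i < ?n" by simp
    have "(?A *\<^sub>v vec ?n (\<lambda>i. num_walks H k (xs ! i))) $ i =
        (\<Sum>j<?n. of_bool ((xs ! i, xs ! j) \<in> parcs H) * num_walks H k (xs ! j))"
      using i adjacency_matrix_carrier[of H xs]
      by (auto simp: scalar_prod_def atLeast0LessThan simp del: adjacency_matrix_carrier intro!: sum.cong)
    then show "(?A *\<^sub>v vec ?n (\<lambda>i. num_walks H k (xs ! i))) $ i =
        vec ?n (\<lambda>i. num_walks H (Suc k) (xs ! i)) $ i"
      using i enumerates_sum[OF xs, of "\<lambda>u. of_bool ((xs ! i, u) \<in> parcs H) * num_walks H k u"]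
      by (simp only: num_walks.simps index_vec)
  qed (simp add: adjacency_matrix_def)
  finally show ?case .
qed

lemma walk_matrix_eq_num_walks:
  assumes "enumerates xs H"
  shows "walk_matrix H xs = mat (length xs) (length xs) (\<lambda>(i, k). num_walks H k (xs ! i))"
  by (rule eq_matI)
    (simp_all add: walk_matrix_def Let_def adjacency_matrix_power_vec[OF assms] mat_of_cols_index)

lemma walk_matrix_carrier:
  "enumerates xs H \<Longrightarrow> walk_matrix H xs \<in> carrier_mat (length xs) (length xs)"
  by (simp add: walk_matrix_eq_num_walks)

section \<open>Independence of the enumeration\<close>

lemma enumerates_length_eq:
  "enumerates xs H \<Longrightarrow> enumerates ys H \<Longrightarrow> length xs = length ys"
  unfolding enumerates_def by (metis distinct_card)

text \<open>Two enumerations differ by a permutation, so the rows are permuted and only the sign of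
  the determinant can change. Leaving \<open>f\<close> arbitrary serves walk matrices as well as
  either side of an adjacency matrix.\<close>

lemma abs_det_row_enumeration:
  fixes f :: "'a \<Rightarrow> nat \<Rightarrow> int"
  assumes xs: "enumerates xs H" and ys: "enumerates ys H" and n: "n = length xs"
  shows "\<bar>det (mat n n (\<lambda>(i, j). f (xs ! i) j))\<bar> = \<bar>det (mat n n (\<lambda>(i, j). f (ys ! i) j))\<bar>"
proof -
  have len: "length ys = n" using enumerates_length_eq[OF xs ys] n by simp
  have "mset xs = mset ys"
    using xs ys set_eq_iff_mset_eq_distinct[of xs ys] by (simp add: enumerates_def)
  then obtain p where p: "p permutes {..<length ys}" "permute_list p ys = xs"
    by (rule mset_eq_permutation)
  let ?Y = "mat n n (\<lambda>(i, j). f (ys ! i) j)"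
  have "mat n n (\<lambda>(i, j). f (xs ! i) j) = mat n n (\<lambda>(i, j). ?Y $$ (p i, j))"
    using p(1) len permutes_in_image[OF p(1)]
    by (intro eq_matI) (auto simp flip: p(2) simp: permute_list_nth)
  then show ?thesis
    using det_permute_rows[of ?Y n p] p(1) len by (simp add: atLeast0LessThan abs_mult sign_def)
qed

lemma abs_det_walk_matrix_enumeration:
  assumes "enumerates xs H" "enumerates ys H"
  shows "\<bar>det (walk_matrix H xs)\<bar> = \<bar>det (walk_matrix H ys)\<bar>"
  using abs_det_row_enumeration[OF assms refl, of "\<lambda>v k. num_walks H k v"]
  by (simp add: walk_matrix_eq_num_walks assms enumerates_length_eq[OF assms])

lemma abs_det_adjacency_matrix_enumeration:
  assumes xs: "enumerates xs H" and ys: "enumerates ys H"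
  shows "\<bar>det (adjacency_matrix H xs)\<bar> = \<bar>det (adjacency_matrix H ys)\<bar>"
proof -
  let ?n = "length xs"
  have len: "length ys = ?n" using enumerates_length_eq[OF xs ys] by simp
  \<comment> \<open>Rows and columns may follow different lists, so that the enumeration can be
    changed on one side at a time.\<close>
  define M where "M us vs = mat ?n ?n (\<lambda>(i, j). of_bool ((us ! i, vs ! j) \<in> parcs H) :: int)" for us vs
  \<comment> \<open>Transposing turns the column list into a row list, to which the row lemma
    applies.\<close>
  have tr: "det (M us vs) = det (mat ?n ?n (\<lambda>(i, j). of_bool ((us ! j, vs ! i) \<in> parcs H)))" for us vs
    by (subst det_transpose[symmetric, of _ ?n]) (auto simp: M_def intro!: arg_cong[of _ _ det])
  have "\<bar>det (adjacency_matrix H xs)\<bar> = \<bar>det (M xs xs)\<bar>"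
    by (simp add: M_def adjacency_matrix_def of_bool_def)
  also have "\<dots> = \<bar>det (M ys xs)\<bar>"
    using abs_det_row_enumeration[OF xs ys refl, of "\<lambda>v j. of_bool ((v, xs ! j) \<in> parcs H)"]
    by (simp add: M_def)
  also have "\<dots> = \<bar>det (M ys ys)\<bar>"
    using abs_det_row_enumeration[OF xs ys refl, of "\<lambda>v j. of_bool ((ys ! j, v) \<in> parcs H)"]
    by (simp add: tr)
  also have "\<dots> = \<bar>det (adjacency_matrix H ys)\<bar>"
    by (simp add: M_def adjacency_matrix_def of_bool_def len)
  finally show ?thesis .
qed

section \<open>Determinants with a unit row or column\<close>

text \<open>Laplace expansion along row \<open>i\<close> leaves the single cofactor at
  \<open>j\<close>, whose sign vanishes in the absolute value.\<close>

lemma abs_det_unit_row: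
  fixes A :: "int mat"
  assumes A: "A \<in> carrier_mat n n" and ij: "i < n" "j < n"
    and row: "\<And>k. k < n \<Longrightarrow> A $$ (i, k) = of_bool (k = j)"
  shows "\<bar>det A\<bar> = \<bar>det (mat_delete A i j)\<bar>"
proof -
  have "det A = (\<Sum>k<n. of_bool (k = j) * cofactor A i k)"
    using laplace_expansion_row[OF A ij(1)] by (simp add: row)
  also have "\<dots> = cofactor A i j"
    using ij(2) by (simp add: sum.remove[of _ j])
  finally show ?thesis
    by (simp add: cofactor_def abs_mult power_abs)
qed

lemma abs_det_unit_column:
  fixes A :: "int mat"
  assumes A: "A \<in> carrier_mat n n" and ij: "i < n" "j < n"
    and col: "\<And>k. k < n \<Longrightarrow> A $$ (k, j) = of_bool (k = i)"
  shows "\<bar>det A\<bar> = \<bar>det (mat_delete A i j)\<bar>"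
proof -
  have "det A = (\<Sum>k<n. of_bool (k = i) * cofactor A k j)"
    using laplace_expansion_column[OF A ij(2)] by (simp add: col)
  also have "\<dots> = cofactor A i j"
    using ij(1) by (simp add: sum.remove[of _ i])
  finally show ?thesis
    by (simp add: cofactor_def abs_mult power_abs)
qed

section \<open>Complements and added vertices\<close>

lemma pverts_simps [simp]:
  "pverts (graph_complement H) = pverts H"
  "pverts (add_isolated_vertex H w) = insert w (pverts H)"
  "pverts (join_vertex H w) = insert w (pverts H)"
  by (simp_all add: graph_complement_def add_isolated_vertex_def join_vertex_def)

lemma enumerates_graph_complement [simp]:
  "enumerates xs (graph_complement H) = enumerates xs H"
  by (simp add: enumerates_def)

text \<open>Loop-freeness, which includes that arcs join vertices of the graph, is the invariant
  kept by all three operations.\<close>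

lemma loopfree_graph_complement: "pair_loopfree_digraph (graph_complement H)"
  by unfold_locales (auto simp: graph_complement_def)

lemma loopfree_add_isolated_vertex:
  "pair_loopfree_digraph H \<Longrightarrow> pair_loopfree_digraph (add_isolated_vertex H w)"
  unfolding pair_loopfree_digraph_def pair_loopfree_digraph_axioms_def pair_wf_digraph_def
  by (auto simp: add_isolated_vertex_def)

lemma loopfree_join_vertex:
  "pair_loopfree_digraph H \<Longrightarrow> w \<notin> pverts H \<Longrightarrow> pair_loopfree_digraph (join_vertex H w)"
  unfolding pair_loopfree_digraph_def pair_loopfree_digraph_axioms_def pair_wf_digraph_def
  by (auto simp: join_vertex_def)

lemma loopfreeD:
  assumes "pair_loopfree_digraph H" "(u, v) \<in> parcs H"
  shows "u \<in> pverts H" "v \<in> pverts H" "u \<noteq> v"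
  using assms
  unfolding pair_loopfree_digraph_def pair_loopfree_digraph_axioms_def pair_wf_digraph_def
  by fastforce+

lemma graph_complement_join_vertex:
  assumes "w \<notin> pverts H"
  shows "graph_complement (join_vertex H w) = add_isolated_vertex (graph_complement H) w"
  using assms by (auto simp: graph_complement_def join_vertex_def add_isolated_vertex_def)

text \<open>No arc of \<open>H\<close> touches the new vertex \<open>w\<close>, because arcs stay
  inside the vertex set; so complementing joins \<open>w\<close> to everything.\<close>

lemma graph_complement_add_isolated_vertex:
  assumes "pair_loopfree_digraph H" "w \<notin> pverts H"
  shows "graph_complement (add_isolated_vertex H w) = join_vertex (graph_complement H) w"
  using assms(2) loopfreeD[OF assms(1)]
  by (auto simp: graph_complement_def join_vertex_def add_isolated_vertex_def)

section \<open>The walk matrix of the complement\<close>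

text \<open>This is \<open>J - I - A\<close> applied to \<open>A^k e\<close>. Arcs of the complement
  are mixed with walk counts of \<open>H\<close> because this is what remains after the induction
  hypothesis is substituted in the next lemma.\<close>

lemma num_walks_graph_complement_Suc:
  assumes H: "pair_loopfree_digraph H" and fin: "finite (pverts H)" and v: "v \<in> pverts H"
  shows "(\<Sum>u\<in>pverts H. of_bool ((v, u) \<in> parcs (graph_complement H)) * num_walks H k u) =
    (\<Sum>u\<in>pverts H. num_walks H k u) - num_walks H k v - num_walks H (Suc k) v"
proof -
  \<comment> \<open>The entrywise form of \<open>J - I - A\<close>; at \<open>u = v\<close> it
    relies on \<open>H\<close> having no loop.\<close>
  have "of_bool ((v, u) \<in> parcs (graph_complement H)) * num_walks H k u =
      num_walks H k u - of_bool (u = v) * num_walks H k u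
        - of_bool ((v, u) \<in> parcs H) * num_walks H k u" if "u \<in> pverts H" for u
    using v that loopfreeD[OF H, of v u] by (auto simp: graph_complement_def)
  then have "(\<Sum>u\<in>pverts H. of_bool ((v, u) \<in> parcs (graph_complement H)) * num_walks H k u) =
      (\<Sum>u\<in>pverts H. num_walks H k u - of_bool (u = v) * num_walks H k u
        - of_bool ((v, u) \<in> parcs H) * num_walks H k u)"
    by (intro sum.cong refl)
  also have "\<dots> = (\<Sum>u\<in>pverts H. num_walks H k u) - num_walks H k v - num_walks H (Suc k) v"
    using fin v by (simp add: sum_subtractf sum.remove[of _ v "\<lambda>u. of_bool (u = v) * num_walks H k u"])
  finally show ?thesis .
qed

text \<open>\<open>J\<close> sends every vector to a multiple of \<open>e\<close>, so
  \<open>J - I - A\<close> maps combinations of \<open>e, ..., A^k e\<close> to combinations of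
  \<open>e, ..., A^(k+1) e\<close> and negates the leading coefficient. The coefficients do not
  depend on \<open>v\<close>; the clause for \<open>j > k\<close> makes them the entries of a
  triangular matrix.\<close>

lemma num_walks_graph_complement:
  assumes H: "pair_loopfree_digraph H" and fin: "finite (pverts H)"
  shows "\<exists>c. c k = (- 1) ^ k \<and> (\<forall>j>k. c j = 0) \<and>
    (\<forall>v\<in>pverts H. num_walks (graph_complement H) k v = (\<Sum>j\<le>k. c j * num_walks H j v))"
proof (induction k)
  case 0
  show ?case by (rule exI[of _ "\<lambda>j. of_bool (j = 0)"]) auto
next
  case (Suc k)
  then obtain c where c: "c k = (- 1) ^ k" "\<And>j. j > k \<Longrightarrow> c j = 0"
    and eq: "\<And>v. v \<in> pverts H \<Longrightarrow> num_walks (graph_complement H) k v = (\<Sum>j\<le>k. c j * num_walks H j v)"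
    by blast
  define S where "S = (\<Sum>j\<le>k. c j * (\<Sum>u\<in>pverts H. num_walks H j u))"
  \<comment> \<open>The three terms come from \<open>J\<close>, \<open>-I\<close> and
    \<open>-A\<close>: the total \<open>S\<close> goes to \<open>e\<close>, and \<open>-A\<close>
    shifts the coefficients by one. The case distinction gives 0 at \<open>j = 0\<close>, where
    \<open>c (j - 1)\<close> would wrongly read \<open>c 0\<close>.\<close>
  define d where "d j = of_bool (j = 0) * S - c j - (case j of 0 \<Rightarrow> 0 | Suc i \<Rightarrow> c i)" for j
  have "num_walks (graph_complement H) (Suc k) v = (\<Sum>j\<le>Suc k. d j * num_walks H j v)"
    if v: "v \<in> pverts H" for v
  proof -
    have "num_walks (graph_complement H) (Suc k) v =
        (\<Sum>u\<in>pverts H. of_bool ((v, u) \<in> parcs (graph_complement H)) * (\<Sum>j\<le>k. c j * num_walks H j u))"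
      by (simp add: eq)
    also have "\<dots> = (\<Sum>j\<le>k. c j * (\<Sum>u\<in>pverts H. of_bool ((v, u) \<in> parcs (graph_complement H))
        * num_walks H j u))"
      unfolding sum_distrib_left by (subst sum.swap) (intro sum.cong refl, simp add: algebra_simps)
    also have "\<dots> = (\<Sum>j\<le>k. c j * ((\<Sum>u\<in>pverts H. num_walks H j u) - num_walks H j v
        - num_walks H (Suc j) v))"
      by (simp only: num_walks_graph_complement_Suc[OF H fin v])
    also have "\<dots> = S - (\<Sum>j\<le>k. c j * num_walks H j v) - (\<Sum>j\<le>k. c j * num_walks H (Suc j) v)"
      unfolding S_def by (simp add: right_diff_distrib sum_subtractf del: num_walks.simps)
    also have "\<dots> = (\<Sum>j\<le>Suc k. d j * num_walks H j v)"
    proof -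
      have "(\<Sum>j\<le>Suc k. d j * num_walks H j v) =
          (\<Sum>j\<le>Suc k. of_bool (j = 0) * S * num_walks H j v) - (\<Sum>j\<le>Suc k. c j * num_walks H j v)
          - (\<Sum>j\<le>Suc k. (case j of 0 \<Rightarrow> 0 | Suc i \<Rightarrow> c i) * num_walks H j v)"
        by (simp only: d_def left_diff_distrib sum_subtractf)
      moreover have "(\<Sum>j\<le>Suc k. of_bool (j = 0) * S * num_walks H j v) = S"
        by (simp add: sum.atMost_Suc_shift del: sum.atMost_Suc)
      moreover have "(\<Sum>j\<le>Suc k. c j * num_walks H j v) = (\<Sum>j\<le>k. c j * num_walks H j v)"
        using c(2) by simp
      moreover have "(\<Sum>j\<le>Suc k. (case j of 0 \<Rightarrow> 0 | Suc i \<Rightarrow> c i) * num_walks H j v) =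
          (\<Sum>j\<le>k. c j * num_walks H (Suc j) v)"
        by (subst sum.atMost_Suc_shift) simp
      ultimately show ?thesis by simp
    qed
    finally show ?thesis .
  qed
  moreover have "d (Suc k) = (- 1) ^ Suc k" "\<forall>j>Suc k. d j = 0"
    using c by (auto simp: d_def split: nat.split)
  ultimately show ?case by blast
qed

lemma abs_det_walk_matrix_graph_complement:
  assumes H: "pair_loopfree_digraph H" and xs: "enumerates xs H"
  shows "\<bar>det (walk_matrix (graph_complement H) xs)\<bar> = \<bar>det (walk_matrix H xs)\<bar>"
proof -
  let ?n = "length xs"
  have "finite (pverts H)" using xs enumerates_finite by blast
  then have "\<forall>k. \<exists>c. c k = (- 1) ^ k \<and> (\<forall>j>k. c j = 0) \<and> (\<forall>v\<in>pverts H.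
      num_walks (graph_complement H) k v = (\<Sum>j\<le>k. c j * num_walks H j v))"
    using num_walks_graph_complement[OF H] by blast
  from choice[OF this] obtain c where c: "\<And>k. c k k = (- 1) ^ k" "\<And>k j. j > k \<Longrightarrow> c k j = 0"
    and eq: "\<And>k v. v \<in> pverts H \<Longrightarrow>
      num_walks (graph_complement H) k v = (\<Sum>j\<le>k. c k j * num_walks H j v)"
    by blast
  \<comment> \<open>Column \<open>k\<close> holds the coefficients for walks of length
    \<open>k\<close>, so \<open>C\<close> multiplies from the right.\<close>
  define C where "C = mat ?n ?n (\<lambda>(j, k). c k j)"
  have C: "C \<in> carrier_mat ?n ?n" by (simp add: C_def)
  have "walk_matrix (graph_complement H) xs = walk_matrix H xs * C"
  proof (rule eq_matI)
    fix i k assume "i < dim_row (walk_matrix H xs * C)" "k < dim_col (walk_matrix H xs * C)"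
    then have i: "i < ?n" and k: "k < ?n" using walk_matrix_carrier[OF xs] C by auto
    then have "xs ! i \<in> pverts H" using xs nth_mem by (fastforce simp: enumerates_def)
    have "(walk_matrix H xs * C) $$ (i, k) = (\<Sum>j<?n. num_walks H j (xs ! i) * c k j)"
      using i k xs by (auto simp: C_def walk_matrix_eq_num_walks scalar_prod_def atLeast0LessThan)
    \<comment> \<open>The coefficients beyond \<open>k\<close> vanish, which cuts the matrix product
      down to the sum in \<open>eq\<close>.\<close>
    also have "\<dots> = (\<Sum>j\<le>k. num_walks H j (xs ! i) * c k j)"
      using k c(2) by (intro sum.mono_neutral_right) auto
    finally show "walk_matrix (graph_complement H) xs $$ (i, k) = (walk_matrix H xs * C) $$ (i, k)"
      using eq[OF \<open>xs ! i \<in> pverts H\<close>] i k xs by (simp add: walk_matrix_eq_num_walks mult.commute)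
  qed (use xs C in \<open>auto simp: walk_matrix_eq_num_walks\<close>)
  moreover have "\<bar>det C\<bar> = 1"
  proof -
    have "upper_triangular C" using c(2) by (auto simp: C_def)
    then have "det C = (\<Prod>i<?n. (- 1) ^ i)"
      using det_upper_triangular[OF _ C] c(1)
      by (simp add: prod_list_diag_prod C_def atLeast0LessThan)
    then show ?thesis by (simp add: abs_prod power_abs)
  qed
  ultimately show ?thesis
    using det_mult[OF walk_matrix_carrier[OF xs] C] by (simp add: abs_mult)
qed

section \<open>Walk matrices after adding a vertex\<close>

text \<open>No arc starts or ends at \<open>w\<close>. The first claim begins at length 1, since the
  trivial walk at \<open>w\<close> is counted at length 0.\<close>

lemma num_walks_add_isolated_vertex:
  assumes H: "pair_loopfree_digraph H" and fin: "finite (pverts H)" and w: "w \<notin> pverts H"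
  shows "num_walks (add_isolated_vertex H w) (Suc k) w = 0"
    and "v \<in> pverts H \<Longrightarrow> num_walks (add_isolated_vertex H w) k v = num_walks H k v"
proof -
  show "num_walks (add_isolated_vertex H w) (Suc k) w = 0"
    using loopfreeD[OF H] w by (auto simp: add_isolated_vertex_def intro!: sum.neutral)
  show "num_walks (add_isolated_vertex H w) k v = num_walks H k v" if "v \<in> pverts H"
    using that
  proof (induction k arbitrary: v)
    case (Suc k)
    have "(v, w) \<notin> parcs (add_isolated_vertex H w)"
      using loopfreeD[OF H] w by (auto simp: add_isolated_vertex_def)
    then show ?case using Suc fin w by (simp add: add_isolated_vertex_def)
  qed simp
qed

lemma abs_det_walk_matrix_add_isolated_vertex:
  assumes H: "pair_loopfree_digraph H" and w: "w \<notin> pverts H" and xs: "enumerates xs H"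
    and zs: "enumerates zs (add_isolated_vertex H w)"
  shows "\<bar>det (walk_matrix (add_isolated_vertex H w) zs)\<bar> =
    \<bar>det (adjacency_matrix H xs)\<bar> * \<bar>det (walk_matrix H xs)\<bar>"
proof -
  let ?n = "length xs" and ?H = "add_isolated_vertex H w"
  let ?W = "walk_matrix ?H (w # xs)"
  have fin: "finite (pverts H)" using xs enumerates_finite by blast
  have wxs: "enumerates (w # xs) ?H" using xs w by (auto simp: enumerates_def)
  have nth: "xs ! i \<in> pverts H" if "i < ?n" for i
    using that xs nth_mem by (fastforce simp: enumerates_def)
  have "\<bar>det (walk_matrix ?H zs)\<bar> = \<bar>det ?W\<bar>"
    by (rule abs_det_walk_matrix_enumeration[OF zs wxs])
  \<comment> \<open>With \<open>w\<close> listed first, row 0 is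
    \<open>(1, 0, ..., 0)\<close>.\<close>
  also have "\<dots> = \<bar>det (mat_delete ?W 0 0)\<bar>"
  proof (rule abs_det_unit_row)
    show "?W \<in> carrier_mat (Suc ?n) (Suc ?n)" using walk_matrix_carrier[OF wxs] by simp
    fix k assume "k < Suc ?n"
    then show "?W $$ (0, k) = of_bool (k = 0)"
      using num_walks_add_isolated_vertex(1)[OF H fin w]
      by (cases k) (simp_all add: walk_matrix_eq_num_walks[OF wxs] del: num_walks.simps(2))
  qed auto
  \<comment> \<open>Dropping column 0 raises every walk length by one: the remaining columns
    \<open>A e, ..., A^n e\<close> form \<open>A W(H)\<close>.\<close>
  also have "mat_delete ?W 0 0 = adjacency_matrix H xs * walk_matrix H xs"
  proof (rule eq_matI)
    fix i k assume "i < dim_row (adjacency_matrix H xs * walk_matrix H xs)"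
      "k < dim_col (adjacency_matrix H xs * walk_matrix H xs)"
    then have i: "i < ?n" and k: "k < ?n"
      using walk_matrix_carrier[OF xs] by (auto simp: adjacency_matrix_def)
    have "(adjacency_matrix H xs * walk_matrix H xs) $$ (i, k) =
        (\<Sum>j<?n. of_bool ((xs ! i, xs ! j) \<in> parcs H) * num_walks H k (xs ! j))"
      using i k xs adjacency_matrix_carrier[of H xs]
      by (auto simp: walk_matrix_eq_num_walks scalar_prod_def atLeast0LessThan
          simp del: adjacency_matrix_carrier intro!: sum.cong)
    also have "\<dots> = num_walks H (Suc k) (xs ! i)"
      using enumerates_sum[OF xs, of "\<lambda>u. of_bool ((xs ! i, u) \<in> parcs H) * num_walks H k u"]
      by (simp only: num_walks.simps)
    also have "\<dots> = mat_delete ?W 0 0 $$ (i, k)"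
      using i k num_walks_add_isolated_vertex(2)[OF H fin w nth[OF i], of "Suc k"]
      by (simp add: mat_delete_def walk_matrix_eq_num_walks[OF wxs] del: num_walks.simps)
    finally show "mat_delete ?W 0 0 $$ (i, k) = (adjacency_matrix H xs * walk_matrix H xs) $$ (i, k)"
      by simp
  qed (use walk_matrix_carrier[OF xs] walk_matrix_carrier[OF wxs] in \<open>auto simp: adjacency_matrix_def\<close>)
  finally show ?thesis
    using det_mult[OF adjacency_matrix_carrier walk_matrix_carrier[OF xs]] by (simp add: abs_mult)
qed

text \<open>Dual to the isolated vertex. Complementing leaves the absolute walk determinant alone,
  so the complement survives only in the adjacency factor.\<close>

lemma abs_det_walk_matrix_join_vertex:
  assumes H: "pair_loopfree_digraph H" and w: "w \<notin> pverts H" and xs: "enumerates xs H"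
    and zs: "enumerates zs (join_vertex H w)"
  shows "\<bar>det (walk_matrix (join_vertex H w) zs)\<bar> =
    \<bar>det (adjacency_matrix (graph_complement H) xs)\<bar> * \<bar>det (walk_matrix H xs)\<bar>"
proof -
  have "\<bar>det (walk_matrix (join_vertex H w) zs)\<bar> =
      \<bar>det (walk_matrix (add_isolated_vertex (graph_complement H) w) zs)\<bar>"
    using abs_det_walk_matrix_graph_complement[OF loopfree_join_vertex[OF H w] zs]
    by (simp add: graph_complement_join_vertex[OF w])
  also have "\<dots> = \<bar>det (adjacency_matrix (graph_complement H) xs)\<bar> *
      \<bar>det (walk_matrix (graph_complement H) xs)\<bar>"
    using w xs zs
    by (intro abs_det_walk_matrix_add_isolated_vertex loopfree_graph_complement)
      (simp_all add: enumerates_def)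
  finally show ?thesis
    by (simp add: abs_det_walk_matrix_graph_complement[OF H xs])
qed

section \<open>Adjacency determinants after adding a pendant vertex\<close>

text \<open>Expanding along the row and then the column of \<open>u\<close> also removes the column
  and the row of \<open>v\<close>, and with them all arcs between \<open>v\<close> and
  \<open>H\<close>.\<close>

lemma abs_det_adjacency_matrix_pendant:
  assumes H: "pair_loopfree_digraph H" and u: "u \<notin> pverts H"
    and v: "v \<notin> pverts (add_isolated_vertex H u)" and xs: "enumerates xs H"
    and zs: "enumerates zs (join_vertex (add_isolated_vertex H u) v)"
  shows "\<bar>det (adjacency_matrix (join_vertex (add_isolated_vertex H u) v) zs)\<bar> =
    \<bar>det (adjacency_matrix H xs)\<bar>"
proof -
  let ?n = "length xs" and ?H = "join_vertex (add_isolated_vertex H u) v"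
  \<comment> \<open>Here \<open>v\<close> has index 0 and \<open>u\<close> has index 1.\<close>
  let ?A = "adjacency_matrix ?H (v # u # xs)"
  have enum: "enumerates (v # u # xs) ?H" using xs u v by (auto simp: enumerates_def)
  have nth: "xs ! i \<in> pverts H" if "i < ?n" for i
    using that xs nth_mem by (fastforce simp: enumerates_def)
  have arcs_u: "(u, x) \<in> parcs ?H \<longleftrightarrow> x = v" "(x, u) \<in> parcs ?H \<longleftrightarrow> x = v"
    if "x \<in> pverts ?H" for x
    using that u v loopfreeD[OF H] by (auto simp: join_vertex_def add_isolated_vertex_def)
  have vs: "(v # u # xs) ! k \<in> pverts ?H" if "k < Suc (Suc ?n)" for k
    using that enum nth_mem[of k "v # u # xs"] by (simp add: enumerates_def del: pverts_simps)
  have eq_v: "(v # u # xs) ! k = v \<longleftrightarrow> k = 0" if "k < Suc (Suc ?n)" for k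
    using that enum nth_eq_iff_index_eq[of "v # u # xs" k 0] by (simp add: enumerates_def)
  have A: "?A \<in> carrier_mat (Suc (Suc ?n)) (Suc (Suc ?n))"
    using adjacency_matrix_carrier[of ?H "v # u # xs"] by simp
  have "\<bar>det (adjacency_matrix ?H zs)\<bar> = \<bar>det ?A\<bar>"
    by (rule abs_det_adjacency_matrix_enumeration[OF zs enum])
  also have "\<dots> = \<bar>det (mat_delete ?A 1 0)\<bar>"
  proof (rule abs_det_unit_row[OF A])
    fix k assume k: "k < Suc (Suc ?n)"
    show "?A $$ (1, k) = of_bool (k = 0)"
      using k vs[OF k] eq_v[OF k] arcs_u(1) by simp
  qed auto
  also have "\<dots> = \<bar>det (mat_delete (mat_delete ?A 1 0) 0 0)\<bar>"
  proof (rule abs_det_unit_column)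
    show "mat_delete ?A 1 0 \<in> carrier_mat (Suc ?n) (Suc ?n)"
      using mat_delete_carrier[OF A, of 1 0] by simp
    fix k assume k: "k < Suc ?n"
    \<comment> \<open>The original index of row \<open>k\<close> before row 1 was deleted. Column 0
      of the minor is the former column 1, belonging to \<open>u\<close>.\<close>
    let ?k = "if k = 0 then 0 else Suc k"
    have "mat_delete ?A 1 0 $$ (k, 0) = ?A $$ (?k, 1)"
      using k A by (simp add: mat_delete_def)
    also have "\<dots> = of_bool (k = 0)"
      using k vs[of ?k] eq_v[of ?k] arcs_u(2) by simp
    finally show "mat_delete ?A 1 0 $$ (k, 0) = of_bool (k = 0)" .
  qed auto
  also have "mat_delete (mat_delete ?A 1 0) 0 0 = adjacency_matrix H xs"
  proof (rule eq_matI)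
    fix i j assume "i < dim_row (adjacency_matrix H xs)" "j < dim_col (adjacency_matrix H xs)"
    then have ij: "i < ?n" "j < ?n" by (simp_all add: adjacency_matrix_def)
    then have "xs ! i \<noteq> v" "xs ! j \<noteq> v" using nth v by auto
    then show "mat_delete (mat_delete ?A 1 0) 0 0 $$ (i, j) = adjacency_matrix H xs $$ (i, j)"
      using ij A by (simp add: mat_delete_def join_vertex_def add_isolated_vertex_def)
  qed (use A in \<open>auto simp: adjacency_matrix_def\<close>)
  finally show ?thesis .
qed

theorem theorem3p3:
  fixes G :: "nat \<Rightarrow> 'a pair_pre_digraph"
    and w :: "nat \<Rightarrow> 'a"
    and xs :: "nat \<Rightarrow> 'a list"
    and a b p :: int
  assumes "pair_graph (G 0)"
    and "inj_on w {1..}"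
    and "\<And>i. i \<ge> 1 \<Longrightarrow> w i \<notin> pverts (G 0)"
    and "\<And>i. i \<ge> 1 \<Longrightarrow> odd i \<Longrightarrow> G i = add_isolated_vertex (G (i - 1)) (w i)"
    and "\<And>i. i \<ge> 1 \<Longrightarrow> even i \<Longrightarrow> G i = join_vertex (G (i - 1)) (w i)"
    and "\<And>i. enumerates (xs i) (G i)"
    and "a = \<bar>det (adjacency_matrix (G 0) (xs 0))\<bar>"
    and "b = \<bar>det (walk_matrix (G 0) (xs 0))\<bar>"
    and "p = \<bar>det (adjacency_matrix (graph_complement (G 1)) (xs 1))\<bar>"
  shows "\<forall>i\<ge>1. \<bar>det (walk_matrix (G i) (xs i))\<bar>
           = a ^ nat \<lceil>real i / 2\<rceil> * b * p ^ nat \<lfloor>real i / 2\<rfloor>"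
proof -
  note inj = assms(2) and new = assms(3) and odd_step = assms(4) and even_step = assms(5)
    and enum = assms(6)
  \<comment> \<open>Knowing exactly which new vertices are present reduces freshness of the next one
    to injectivity of \<open>w\<close>.\<close>
  have verts: "pverts (G i) = pverts (G 0) \<union> w ` {1..i}" for i
  proof (induction i)
    case (Suc i)
    then show ?case
      using odd_step[of "Suc i"] even_step[of "Suc i"]
      by (cases "even i") (auto simp: atLeastAtMostSuc_conv)
  qed simp
  have fresh: "w (Suc i) \<notin> pverts (G i)" for i
  proof -
    have old: "w (Suc i) \<noteq> w k" if "k \<in> {1..i}" for k
      using inj_onD[OF inj, of "Suc i" k] that by auto
    have "w (Suc i) \<notin> pverts (G 0)" by (simp add: new)
    then show ?thesis using old unfolding verts[of i] by blast
  qed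
  have iso: "G (Suc i) = add_isolated_vertex (G i) (w (Suc i))" if "even i" for i
    using odd_step[of "Suc i"] that by simp
  have join: "G (Suc i) = join_vertex (G i) (w (Suc i))" if "odd i" for i
    using even_step[of "Suc i"] that by simp
  have loopfree: "pair_loopfree_digraph (G i)" for i
  proof (induction i)
    case 0
    interpret pair_graph "G 0" by (fact assms(1))
    show ?case by unfold_locales
  next
    case (Suc i)
    then show ?case
      using iso[of i] join[of i] loopfree_add_isolated_vertex[of "G i"]
        loopfree_join_vertex[OF _ fresh[of i]]
      by (cases "even i") auto
  qed
  \<comment> \<open>Two steps from an even index attach the pendant vertex \<open>w (Suc i)\<close>
    to \<open>w (Suc (Suc i))\<close>.\<close>
  have pendant: "G (Suc (Suc i)) = join_vertex (add_isolated_vertex (G i) (w (Suc i))) (w (Suc (Suc i)))"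
    if "even i" for i
    using iso[of i] join[of "Suc i"] that by simp
  \<comment> \<open>From an odd index the join comes first; complementation swaps the two operations
    and restores the pendant pattern.\<close>
  have pendant_complement: "graph_complement (G (Suc (Suc i))) =
      join_vertex (add_isolated_vertex (graph_complement (G i)) (w (Suc i))) (w (Suc (Suc i)))"
    if "odd i" for i
    using join[of i] iso[of "Suc i"] that fresh[of i]
      graph_complement_add_isolated_vertex[OF loopfree[of "Suc i"] fresh[of "Suc i"]]
    by (simp add: graph_complement_join_vertex)
  have det_even: "\<bar>det (adjacency_matrix (G (2 * j)) (xs (2 * j)))\<bar> = a" for j
  proof (induction j)
    case 0
    then show ?case using assms(7) by simp
  next
    case (Suc j)
    let ?i = "2 * j"
    have "\<bar>det (adjacency_matrix (G (Suc (Suc ?i))) (xs (Suc (Suc ?i))))\<bar> =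
        \<bar>det (adjacency_matrix (G ?i) (xs ?i))\<bar>"
      using abs_det_adjacency_matrix_pendant[OF loopfree[of ?i] fresh[of ?i], of "w (Suc (Suc ?i))"]
        enum[of "Suc (Suc ?i)"] enum[of ?i] fresh[of "Suc ?i"] pendant[of ?i] iso[of ?i]
      by simp
    then show ?case using Suc.IH by simp
  qed
  have det_odd: "\<bar>det (adjacency_matrix (graph_complement (G (Suc (2 * j)))) (xs (Suc (2 * j))))\<bar> = p"
    for j
  proof (induction j)
    case 0
    then show ?case using assms(9) by simp
  next
    case (Suc j)
    let ?i = "Suc (2 * j)"
    \<comment> \<open>The pendant lemma is applied with the complement of \<open>G ?i\<close> as its
      base graph, so the enumerations are needed in this form.\<close>
    have "enumerates (xs (Suc (Suc ?i))) (graph_complement (G (Suc (Suc ?i))))"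
      "enumerates (xs ?i) (graph_complement (G ?i))"
      using enum by simp_all
    then have "\<bar>det (adjacency_matrix (graph_complement (G (Suc (Suc ?i)))) (xs (Suc (Suc ?i))))\<bar> =
        \<bar>det (adjacency_matrix (graph_complement (G ?i)) (xs ?i))\<bar>"
      using abs_det_adjacency_matrix_pendant[OF loopfree_graph_complement[of "G ?i"],
          of "w (Suc ?i)" "w (Suc (Suc ?i))"]
        fresh[of ?i] fresh[of "Suc ?i"] pendant_complement[of ?i] join[of ?i]
      by (simp del: enumerates_graph_complement)
    then show ?case using Suc.IH by simp
  qed
  \<comment> \<open>Including \<open>i = 0\<close>, where the value is \<open>b\<close>, gives the
    induction its base. Integer division stands for the ceiling and floor of
    \<open>i/2\<close>.\<close>
  have det_walk: "\<bar>det (walk_matrix (G i) (xs i))\<bar> = a ^ (Suc i div 2) * b * p ^ (i div 2)" for i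
  proof (induction i)
    case 0
    then show ?case using assms(8) by simp
  next
    case (Suc i)
    show ?case
    proof (cases "even i")
      case True
      then obtain j where j: "i = 2 * j" by blast
      \<comment> \<open>The new factor is the adjacency determinant of \<open>G i\<close> with
        \<open>i\<close> even, which \<open>det_even\<close> keeps at \<open>a\<close>; in the odd
        case \<open>det_odd\<close> supplies \<open>p\<close>.\<close>
      have "\<bar>det (walk_matrix (G (Suc i)) (xs (Suc i)))\<bar> = a * \<bar>det (walk_matrix (G i) (xs i))\<bar>"
        using abs_det_walk_matrix_add_isolated_vertex[OF loopfree[of i] fresh[of i] enum[of i], of "xs (Suc i)"]
          enum[of "Suc i"] iso[OF True] det_even[of j] j by simp
      then show ?thesis using Suc.IH j by simp
    next
      case False
      then obtain j where j: "i = Suc (2 * j)" by (auto elim: oddE)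
      have "\<bar>det (walk_matrix (G (Suc i)) (xs (Suc i)))\<bar> = p * \<bar>det (walk_matrix (G i) (xs i))\<bar>"
        using abs_det_walk_matrix_join_vertex[OF loopfree[of i] fresh[of i] enum[of i], of "xs (Suc i)"]
          enum[of "Suc i"] join[OF False] det_odd[of j] j by simp
      then show ?thesis using Suc.IH j by simp
    qed
  qed
  have "nat \<lceil>real i / 2\<rceil> = Suc i div 2" "nat \<lfloor>real i / 2\<rfloor> = i div 2" for i
    by linarith+
  then show ?thesis using det_walk by simp
qed

end
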